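(* Let $X$ be a countably infinite set. The lattice $M_{2^\omega}$ is isomorphic to a sublattice of $\mathrm{Cl}_{loc}(X)$.
   Context: $M_{2^\omega}$ is the lattice consisting of an antichain of cardinality $2^{\omega}$ (the continuum) plus a smallest and a largest element. For $n\ge 1$, let $\mathscr O^{(n)}=X^{X^n}$ be the set of $n$-ary operations on $X$ and $\mathscr O=\bigcup_{n\ge1}\mathscr O^{(n)}$. A clone on $X$ is a subset of $\mathscr O$ that contains all projections $\pi^n_k(x_1,\dots,x_n)=x_k$ ($1\le k\le n$) and is closed under composition: if $f$ is an $n$-ary member and $g_1,\dots,g_n$ are $m$-ary members, then $f(g_1,\dots,g_n)$ is a member. Equip $X$ with the discrete topology and each $\mathscr O^{(n)}=X^{X^n}$ with the product topology. A clone $\mathscr C$ is local (locally closed) iff $\mathscr C\cap\mathscr O^{(n)}$ is closed in $\mathscr O^{(n)}$ for every $n\ge1$. $\mathrm{Cl}_{loc}(X)$ is the complete lattice of all local clones on $X$ ordered by inclusion. *)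

theory Defs
  imports "HOL-Analysis.Function_Topology" "HOL-Algebra.Complete_Lattice"
begin

subsection \<open>Finitary operations and local clones\<close>

definition tuples :: "'a set \<Rightarrow> nat \<Rightarrow> 'a list set" where
  "tuples X n = {xs. length xs = n \<and> set xs \<subseteq> X}"

definition operations :: "'a set \<Rightarrow> nat \<Rightarrow> ('a list \<Rightarrow> 'a) set" where
  "operations X n = tuples X n \<rightarrow>\<^sub>E X"

definition operation_topology :: "'a set \<Rightarrow> nat \<Rightarrow> ('a list \<Rightarrow> 'a) topology" where
  "operation_topology X n = product_topology (\<lambda>_. discrete_topology X) (tuples X n)"

text \<open>
  Extensional functions do not determine their domain: the function that is constantly
  \<^term>\<open>undefined\<close> may lie in \<^term>\<open>operations X n\<close> for several \<open>n\<close>. Elements of the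
  union of all \<^term>\<open>operations X n\<close> therefore carry their arity, so that this union is disjoint.
\<close>

definition all_operations :: "'a set \<Rightarrow> (nat \<times> ('a list \<Rightarrow> 'a)) set" where
  "all_operations X = (SIGMA n:{1..}. operations X n)"

definition projection :: "'a set \<Rightarrow> nat \<Rightarrow> nat \<Rightarrow> 'a list \<Rightarrow> 'a" where
  "projection X n k = (\<lambda>xs\<in>tuples X n. xs ! k)"

definition composition ::
    "'a set \<Rightarrow> nat \<Rightarrow> ('a list \<Rightarrow> 'a) \<Rightarrow> ('a list \<Rightarrow> 'a) list \<Rightarrow> 'a list \<Rightarrow> 'a" where
  "composition X m f gs = (\<lambda>xs\<in>tuples X m. f (map (\<lambda>g. g xs) gs))"

definition clone :: "'a set \<Rightarrow> (nat \<times> ('a list \<Rightarrow> 'a)) set \<Rightarrow> bool" where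
  "clone X C \<longleftrightarrow>
     C \<subseteq> all_operations X \<and>
     (\<forall>n\<ge>1. \<forall>k<n. (n, projection X n k) \<in> C) \<and>
     (\<forall>n m f gs. (n, f) \<in> C \<and> length gs = n \<and> (\<forall>g\<in>set gs. (m, g) \<in> C)
        \<longrightarrow> (m, composition X m f gs) \<in> C)"

text \<open>The image \<^term>\<open>C `` {n}\<close> is the \<open>n\<close>-ary part of \<open>C\<close>.\<close>

definition local_clone :: "'a set \<Rightarrow> (nat \<times> ('a list \<Rightarrow> 'a)) set \<Rightarrow> bool" where
  "local_clone X C \<longleftrightarrow>
     clone X C \<and> (\<forall>n\<ge>1. closedin (operation_topology X n) (C `` {n}))"

definition Cl_loc :: "'a set \<Rightarrow> (nat \<times> ('a list \<Rightarrow> 'a)) set gorder" where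
  "Cl_loc X = \<lparr>carrier = {C. local_clone X C}, eq = (=), le = (\<subseteq>)\<rparr>"


subsection \<open>The lattices \<open>M\<^sub>\<kappa>\<close>\<close>

datatype 'i m_element = MBot | MAtom 'i | MTop

definition M_lattice :: "'i set \<Rightarrow> 'i m_element gorder" where
  "M_lattice I = \<lparr>carrier = {MBot, MTop} \<union> MAtom ` I, eq = (=),
     le = (\<lambda>x y. x = MBot \<or> x = y \<or> y = MTop)\<rparr>"

definition M_continuum :: "nat set m_element gorder" where
  "M_continuum = M_lattice (Pow (UNIV :: nat set))"


subsection \<open>Sublattices and isomorphisms\<close>

definition sublattice :: "'a set \<Rightarrow> ('a, 'b) gorder_scheme \<Rightarrow> bool" where
  "sublattice S L \<longleftrightarrow>
     lattice L \<and> S \<subseteq> carrier L \<and>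
     (\<forall>x\<in>S. \<forall>y\<in>S. x \<squnion>\<^bsub>L\<^esub> y \<in> S \<and> x \<sqinter>\<^bsub>L\<^esub> y \<in> S)"

definition lattice_isomorphic ::
    "('a, 'c) gorder_scheme \<Rightarrow> ('b, 'd) gorder_scheme \<Rightarrow> bool" where
  "lattice_isomorphic K L \<longleftrightarrow>
     (\<exists>\<phi>. bij_betw \<phi> (carrier K) (carrier L) \<and> join_pres K L \<phi> \<and> meet_pres K L \<phi>)"


subsection \<open>Basic facts\<close>

lemma topspace_operation_topology: "topspace (operation_topology X n) = operations X n"
  by (simp add: operation_topology_def operations_def)

lemma projection_in_operations: "k < n \<Longrightarrow> projection X n k \<in> operations X n"
  unfolding projection_def operations_def tuples_def
  by (auto simp: subset_iff in_set_conv_nth)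

lemma composition_in_operations:
  assumes "f \<in> operations X n" "length gs = n" "set gs \<subseteq> operations X m"
  shows "composition X m f gs \<in> operations X m"
  unfolding operations_def composition_def
proof (intro restrict_PiE_iff[THEN iffD2] ballI)
  fix xs assume "xs \<in> tuples X m"
  then have "map (\<lambda>g. g xs) gs \<in> tuples X n"
    using assms(2,3) unfolding operations_def tuples_def by (fastforce simp: PiE_iff)
  then show "f (map (\<lambda>g. g xs) gs) \<in> X"
    using assms(1) by (auto simp: operations_def PiE_iff)
qed

lemma local_clone_all_operations: "local_clone X (all_operations X)"
proof -
  have "(m, composition X m f gs) \<in> all_operations X"
    if "(n, f) \<in> all_operations X" "length gs = n" "\<forall>g\<in>set gs. (m, g) \<in> all_operations X"
    for n m f gs
  proof -
    from that have "gs \<noteq> []"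
      by (auto simp: all_operations_def)
    with that have "m \<ge> 1"
      by (cases gs) (auto simp: all_operations_def)
    with that show ?thesis
      using composition_in_operations[of f X n gs m] by (auto simp: all_operations_def)
  qed
  moreover have "all_operations X `` {n} = topspace (operation_topology X n)" if "n \<ge> 1" for n
    using that by (auto simp: all_operations_def topspace_operation_topology)
  ultimately show ?thesis
    unfolding local_clone_def clone_def
    by (auto simp: projection_in_operations all_operations_def)
qed

lemma local_clone_Inter:
  assumes "\<A> \<noteq> {}" "\<And>C. C \<in> \<A> \<Longrightarrow> local_clone X C"
  shows "local_clone X (\<Inter>\<A>)"
proof -
  have "clone X (\<Inter>\<A>)"
    unfolding clone_def
  proof (intro conjI allI impI)
    show "\<Inter>\<A> \<subseteq> all_operations X"
      using assms by (fastforce simp: local_clone_def clone_def)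
  qed (use assms(2) in \<open>auto simp: local_clone_def clone_def\<close>)
  moreover have "closedin (operation_topology X n) (\<Inter>\<A> `` {n})" if "n \<ge> 1" for n
  proof -
    have "\<Inter>\<A> `` {n} = \<Inter>((\<lambda>C. C `` {n}) ` \<A>)"
      by auto
    then show ?thesis
      using assms that by (auto simp: local_clone_def intro!: closedin_Inter)
  qed
  ultimately show ?thesis
    by (simp add: local_clone_def)
qed

lemma complete_lattice_Cl_loc: "complete_lattice (Cl_loc X)"
proof -
  interpret partial_order "Cl_loc X"
    by unfold_locales (auto simp: Cl_loc_def)
  show ?thesis
  proof (rule complete_lattice_criterion1)
    show "\<exists>g. greatest (Cl_loc X) g (carrier (Cl_loc X))"
      using local_clone_all_operations[of X]
      by (intro exI[of _ "all_operations X"])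
        (auto simp: greatest_def Cl_loc_def local_clone_def clone_def)
  next
    fix A assume A: "A \<subseteq> carrier (Cl_loc X)" "A \<noteq> {}"
    then have "local_clone X (\<Inter>A)"
      by (intro local_clone_Inter) (auto simp: Cl_loc_def)
    with A show "\<exists>i. greatest (Cl_loc X) i (Lower (Cl_loc X) A)"
      by (intro exI[of _ "\<Inter>A"]) (auto simp: greatest_def Lower_def Cl_loc_def)
  qed
qed

lemma lattice_Cl_loc: "lattice (Cl_loc X)"
proof -
  interpret complete_lattice "Cl_loc X"
    by (rule complete_lattice_Cl_loc)
  show ?thesis
    by (rule lattice_axioms)
qed

lemma lattice_M_lattice: "lattice (M_lattice I)"
proof -
  interpret partial_order "M_lattice I"
    by unfold_locales (auto simp: M_lattice_def)
  show ?thesis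
  proof unfold_locales
    fix x y assume xy: "x \<in> carrier (M_lattice I)" "y \<in> carrier (M_lattice I)"
    show "\<exists>s. least (M_lattice I) s (Upper (M_lattice I) {x, y})"
      using xy
      by (intro exI[of _ "if x = MBot \<or> x = y then y else if y = MBot then x else MTop"])
        (auto simp: least_def Upper_def M_lattice_def)
    show "\<exists>s. greatest (M_lattice I) s (Lower (M_lattice I) {x, y})"
      using xy
      by (intro exI[of _ "if x = MTop \<or> x = y then y else if y = MTop then x else MBot"])
        (auto simp: greatest_def Lower_def M_lattice_def)
  qed
qed

lemma
  assumes "sublattice S L"
  shows lattice_sublattice: "lattice (L\<lparr>carrier := S\<rparr>)"
    and join_sublattice: "x \<in> S \<Longrightarrow> y \<in> S \<Longrightarrow> x \<squnion>\<^bsub>L\<lparr>carrier := S\<rparr>\<^esub> y = x \<squnion>\<^bsub>L\<^esub> y"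
    and meet_sublattice: "x \<in> S \<Longrightarrow> y \<in> S \<Longrightarrow> x \<sqinter>\<^bsub>L\<lparr>carrier := S\<rparr>\<^esub> y = x \<sqinter>\<^bsub>L\<^esub> y"
proof -
  let ?K = "L\<lparr>carrier := S\<rparr>"
  interpret lattice L
    using assms by (simp add: sublattice_def)
  have S: "S \<subseteq> carrier L"
    and closed: "\<And>x y. x \<in> S \<Longrightarrow> y \<in> S \<Longrightarrow> x \<squnion>\<^bsub>L\<^esub> y \<in> S \<and> x \<sqinter>\<^bsub>L\<^esub> y \<in> S"
    using assms by (auto simp: sublattice_def)
  interpret K: partial_order ?K
    using S by unfold_locales (auto simp: subset_iff eq_is_equal intro: le_trans)
  have least: "least ?K (x \<squnion>\<^bsub>L\<^esub> y) (Upper ?K {x, y})" if "x \<in> S" "y \<in> S" for x y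
    using that S closed[OF that] join_left[of x y] join_right[of x y] join_le[of x _ y]
    by (auto simp: least_def Upper_def subset_iff)
  have greatest: "greatest ?K (x \<sqinter>\<^bsub>L\<^esub> y) (Lower ?K {x, y})" if "x \<in> S" "y \<in> S" for x y
    using that S closed[OF that] meet_left[of x y] meet_right[of x y] meet_le[of _ x y]
    by (auto simp: greatest_def Lower_def subset_iff)
  show K: "lattice ?K"
  proof unfold_locales
    fix x y assume "x \<in> carrier ?K" "y \<in> carrier ?K"
    then have xy: "x \<in> S" "y \<in> S"
      by simp_all
    show "\<exists>s. least ?K s (Upper ?K {x, y})"
      using least[OF xy] by (rule exI)
    show "\<exists>s. greatest ?K s (Lower ?K {x, y})"
      using greatest[OF xy] by (rule exI)
  qed
  show "x \<squnion>\<^bsub>?K\<^esub> y = x \<squnion>\<^bsub>L\<^esub> y" if "x \<in> S" "y \<in> S"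
    unfolding join_def[of ?K] sup_def[of ?K]
    using least[OF that] by (rule some_equality) (blast intro: K.least_unique least[OF that])
  show "x \<sqinter>\<^bsub>?K\<^esub> y = x \<sqinter>\<^bsub>L\<^esub> y" if "x \<in> S" "y \<in> S"
    unfolding meet_def[of ?K] inf_def[of ?K]
    using greatest[OF that] by (rule some_equality) (blast intro: K.greatest_unique greatest[OF that])
qed

end

theory Submission
  imports Defs "HOL-Library.Product_Plus" "HOL-Computational_Algebra.Formal_Laurent_Series"
begin

text \<open>
  The lattice \<open>M\<^sub>\<kappa>\<close> is first found among the closed subgroups of a topological group, and that
  part of the subgroup lattice is then transported to local clones.

  Let \<open>K = \<rat>((t))\<close> be the field of formal Laurent series and \<open>G = K \<times> K\<close>. The lines
  \<open>{(x, a x) | x \<in> K}\<close> are subgroups of \<open>G\<close>; because \<open>K\<close> is a field, any two of them meet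
  only in \<open>0\<close> and add up to \<open>G\<close>. Multiplication by a fixed \<open>a\<close> is continuous for the
  \<open>t\<close>-adic topology, so lines are closed, and already the slopes with coefficients in \<open>{0, 1}\<close> and
  no negative powers of \<open>t\<close> give continuum many of them. With \<open>{0}\<close> and \<open>G\<close> they form a copy
  of the required lattice.

  The topology of \<open>G\<close> is given by a decreasing chain of subgroups \<open>U n\<close>, each of which has only
  countably many cosets. Hence \<open>G\<close> acts by translations on a countably infinite set, the set of
  all cosets of all \<open>U n\<close>, which may be taken to be \<open>X\<close>. The action is faithful because
  the \<open>U n\<close> meet in \<open>0\<close>. Since \<open>G\<close> is complete, a pointwise limit of translations is again a
  translation, and so every closed subgroup \<open>H\<close> gives a set of self-maps of \<open>X\<close> that is closed in
  \<open>X\<^sup>X\<close> (\<open>translation_action\<close>).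

  The operations \<open>(x\<^sub>1, \<dots>, x\<^sub>n) \<mapsto> h x\<^sub>k\<close> with \<open>h \<in> H\<close> form a local clone. Passing from \<open>H\<close> to this
  clone is an order embedding that respects intersections (\<open>unary_clone_Int\<close>), and a
  clone above those of \<open>H\<close> and \<open>H'\<close> contains the one of \<open>H + H'\<close>
  (\<open>compose_unary_clone_subset\<close>). Complementary subgroups therefore become
  local clones with the expected joins and meets.
\<close>

section \<open>Copies of \<open>M\<^sub>\<kappa>\<close> inside a lattice\<close>

lemma (in lattice) join_eqI:
  assumes "x \<in> carrier L" "y \<in> carrier L" "s \<in> carrier L" "x \<sqsubseteq> s" "y \<sqsubseteq> s"
    and "\<And>u. u \<in> carrier L \<Longrightarrow> x \<sqsubseteq> u \<Longrightarrow> y \<sqsubseteq> u \<Longrightarrow> s \<sqsubseteq> u"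
  shows "x \<squnion> y = s"
proof (rule le_antisym)
  show "x \<squnion> y \<sqsubseteq> s" using assms(1-5) by (intro join_le)
  show "s \<sqsubseteq> x \<squnion> y" using assms(1,2) by (intro assms(6) join_left join_right join_closed)
qed (use assms(1-3) in auto)

lemma (in lattice) meet_eqI:
  assumes "x \<in> carrier L" "y \<in> carrier L" "s \<in> carrier L" "s \<sqsubseteq> x" "s \<sqsubseteq> y"
    and "\<And>u. u \<in> carrier L \<Longrightarrow> u \<sqsubseteq> x \<Longrightarrow> u \<sqsubseteq> y \<Longrightarrow> u \<sqsubseteq> s"
  shows "x \<sqinter> y = s"
proof (rule le_antisym)
  show "s \<sqsubseteq> x \<sqinter> y" using assms(1-5) by (intro meet_le)
  show "x \<sqinter> y \<sqsubseteq> s" using assms(1,2) by (intro assms(6) meet_left meet_right meet_closed)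
qed (use assms(1-3) in auto)

lemma join_M_lattice:
  assumes "x \<in> carrier (M_lattice I)" "y \<in> carrier (M_lattice I)"
  shows "x \<squnion>\<^bsub>M_lattice I\<^esub> y =
    (if x = MBot \<or> x = y then y else if y = MBot then x else MTop)"
  using assms
  by (intro lattice.join_eqI[OF lattice_M_lattice]) (auto simp: M_lattice_def)

lemma meet_M_lattice:
  assumes "x \<in> carrier (M_lattice I)" "y \<in> carrier (M_lattice I)"
  shows "x \<sqinter>\<^bsub>M_lattice I\<^esub> y =
    (if x = MTop \<or> x = y then y else if y = MTop then x else MBot)"
  using assms
  by (intro lattice.meet_eqI[OF lattice_M_lattice]) (auto simp: M_lattice_def)

text \<open>
  The map \<open>a\<close> is injective on \<open>I\<close>: if \<open>a i = a j\<close> with \<open>i \<noteq> j\<close>, then the meet and the join of the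
  two coincide, contrary to \<open>b \<noteq> t\<close>.
\<close>

lemma (in lattice) M_lattice_isomorphic_sublattice:
  assumes carrier: "b \<in> carrier L" "t \<in> carrier L" "\<And>i. i \<in> I \<Longrightarrow> a i \<in> carrier L"
    and le: "b \<sqsubseteq> t" "\<And>i. i \<in> I \<Longrightarrow> b \<sqsubseteq> a i" "\<And>i. i \<in> I \<Longrightarrow> a i \<sqsubseteq> t"
    and neq: "b \<noteq> t" "\<And>i. i \<in> I \<Longrightarrow> b \<noteq> a i" "\<And>i. i \<in> I \<Longrightarrow> a i \<noteq> t"
    and join: "\<And>i j. i \<in> I \<Longrightarrow> j \<in> I \<Longrightarrow> i \<noteq> j \<Longrightarrow> a i \<squnion> a j = t"
    and meet: "\<And>i j. i \<in> I \<Longrightarrow> j \<in> I \<Longrightarrow> i \<noteq> j \<Longrightarrow> a i \<sqinter> a j = b"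
  shows "\<exists>S. sublattice S L \<and> lattice_isomorphic (M_lattice I) (L\<lparr>carrier := S\<rparr>)"
proof -
  define \<phi> where "\<phi> = case_m_element b a t"
  define S where "S = \<phi> ` carrier (M_lattice I)"
  have [simp]: "\<phi> MBot = b" "\<phi> (MAtom i) = a i" "\<phi> MTop = t" for i
    by (simp_all add: \<phi>_def)
  have idem: "x \<squnion> x = x" "x \<sqinter> x = x" if "x \<in> carrier L" for x
    using that le_iff_meet[of x x] le_iff_join[of x x] by auto
  have comparable: "x \<squnion> y = y" "y \<squnion> x = y" "x \<sqinter> y = x" "y \<sqinter> x = x"
    if "x \<in> carrier L" "y \<in> carrier L" "x \<sqsubseteq> y" for x y
    using that le_iff_meet[of x y] le_iff_join[of x y] join_comm[of L x y] meet_comm[of L x y]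
    by auto
  have inj_a: "a i \<noteq> a j" if "i \<in> I" "j \<in> I" "i \<noteq> j" for i j
  proof
    assume "a i = a j"
    with join[OF that] meet[OF that] idem carrier(3) that show False
      using neq(1) by auto
  qed
  have SL: "S \<subseteq> carrier L"
    using carrier by (auto simp: S_def M_lattice_def)
  have pres: "\<phi> (x \<squnion>\<^bsub>M_lattice I\<^esub> y) = \<phi> x \<squnion> \<phi> y" "\<phi> (x \<sqinter>\<^bsub>M_lattice I\<^esub> y) = \<phi> x \<sqinter> \<phi> y"
    if "x \<in> carrier (M_lattice I)" "y \<in> carrier (M_lattice I)" for x y
    using that carrier le unfolding join_M_lattice[OF that] meet_M_lattice[OF that]
    by (auto simp: M_lattice_def comparable idem join meet)
  have closed: "x \<squnion>\<^bsub>M_lattice I\<^esub> y \<in> carrier (M_lattice I) \<and> x \<sqinter>\<^bsub>M_lattice I\<^esub> y \<in> carrier (M_lattice I)"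
    if "x \<in> carrier (M_lattice I)" "y \<in> carrier (M_lattice I)" for x y
    using that by (auto simp: join_M_lattice meet_M_lattice) (auto simp: M_lattice_def)
  have sub: "sublattice S L"
    unfolding sublattice_def
  proof (intro conjI ballI)
    show "lattice L" by (rule lattice_axioms)
    show "S \<subseteq> carrier L" by (rule SL)
  next
    fix u v assume "u \<in> S" "v \<in> S"
    then obtain x y where xy: "x \<in> carrier (M_lattice I)" "y \<in> carrier (M_lattice I)"
        "u = \<phi> x" "v = \<phi> y"
      by (auto simp: S_def)
    show "u \<squnion> v \<in> S" "u \<sqinter> v \<in> S"
      using closed[OF xy(1,2)] pres[OF xy(1,2), symmetric] by (auto simp: xy S_def)
  qed
  have "inj_on \<phi> (carrier (M_lattice I))"
    using neq neq[symmetric] inj_a by (auto simp: inj_on_def M_lattice_def)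
  then have "bij_betw \<phi> (carrier (M_lattice I)) (carrier (L\<lparr>carrier := S\<rparr>))"
    by (simp add: bij_betw_def S_def)
  moreover have "join_pres (M_lattice I) (L\<lparr>carrier := S\<rparr>) \<phi>"
    using lattice_M_lattice lattice_sublattice[OF sub] pres(1) join_sublattice[OF sub]
    by (auto simp: join_pres_def S_def)
  moreover have "meet_pres (M_lattice I) (L\<lparr>carrier := S\<rparr>) \<phi>"
    using lattice_M_lattice lattice_sublattice[OF sub] pres(2) meet_sublattice[OF sub]
    by (auto simp: meet_pres_def S_def)
  ultimately show ?thesis
    using sub by (auto simp: lattice_isomorphic_def)
qed

lemma meet_Cl_loc:
  assumes "local_clone X C" "local_clone X D"
  shows "C \<sqinter>\<^bsub>Cl_loc X\<^esub> D = C \<inter> D"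
  using assms local_clone_Inter[of "{C, D}" X]
  by (intro lattice.meet_eqI[OF lattice_Cl_loc]) (auto simp: Cl_loc_def)

lemma join_Cl_loc_eqI:
  assumes "local_clone X C" "local_clone X D" "local_clone X E" "C \<subseteq> E" "D \<subseteq> E"
    and "\<And>F. local_clone X F \<Longrightarrow> C \<subseteq> F \<Longrightarrow> D \<subseteq> F \<Longrightarrow> E \<subseteq> F"
  shows "C \<squnion>\<^bsub>Cl_loc X\<^esub> D = E"
  using assms by (intro lattice.join_eqI[OF lattice_Cl_loc]) (auto simp: Cl_loc_def)


section \<open>Local clones of essentially unary operations\<close>

abbreviation pointwise_topology :: "'b set \<Rightarrow> 'a set \<Rightarrow> ('b \<Rightarrow> 'a) topology" where
  "pointwise_topology A B \<equiv> product_topology (\<lambda>_. discrete_topology B) A"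

text \<open>
  Basic open sets of a product of discrete spaces prescribe finitely many values. The two
  cases of interest are the self-maps of a set and its \<open>n\<close>-ary operations.
\<close>

lemma closedin_pointwise_topology:
  "closedin (pointwise_topology A B) M \<longleftrightarrow>
     M \<subseteq> A \<rightarrow>\<^sub>E B \<and>
     (\<forall>f\<in>A \<rightarrow>\<^sub>E B. (\<forall>F. finite F \<longrightarrow> F \<subseteq> A \<longrightarrow> (\<exists>g\<in>M. \<forall>x\<in>F. g x = f x)) \<longrightarrow> f \<in> M)"
    (is "?closed \<longleftrightarrow> M \<subseteq> ?T \<and> ?R")
proof -
  have "openin (pointwise_topology A B) (?T - M) \<longleftrightarrow> ?R" if MT: "M \<subseteq> ?T"
  proof
    assume op: "openin (pointwise_topology A B) (?T - M)"
    show ?R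
    proof (rule ballI, rule impI, rule ccontr)
      fix f assume f: "f \<in> ?T" "f \<notin> M"
        and approx: "\<forall>F. finite F \<longrightarrow> F \<subseteq> A \<longrightarrow> (\<exists>g\<in>M. \<forall>x\<in>F. g x = f x)"
      obtain W where W: "finite {x \<in> A. W x \<noteq> B}" "f \<in> Pi\<^sub>E A W" "Pi\<^sub>E A W \<subseteq> ?T - M"
        using op f unfolding openin_product_topology_alt
        by (metis DiffI topspace_discrete_topology)
      obtain g where g: "g \<in> M" "\<forall>x\<in>{x \<in> A. W x \<noteq> B}. g x = f x"
        using approx W(1) by (metis (no_types, lifting) mem_Collect_eq subsetI)
      with MT have gT: "g \<in> ?T" by auto
      have "g \<in> Pi\<^sub>E A W"
      proof (rule PiE_I)
        fix x assume "x \<in> A"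
        then show "g x \<in> W x"
          using gT g(2) W(2) by (cases "W x = B") (auto simp: PiE_iff)
      qed (use gT in \<open>auto simp: PiE_iff extensional_def\<close>)
      with W(3) g(1) show False by auto
    qed
  next
    assume R: ?R
    show "openin (pointwise_topology A B) (?T - M)"
      unfolding openin_product_topology_alt
    proof
      fix f assume f: "f \<in> ?T - M"
      then have "f \<in> ?T" "f \<notin> M" by auto
      with bspec[OF R, of f] obtain F where F: "finite F" "F \<subseteq> A" "\<forall>g\<in>M. \<exists>x\<in>F. g x \<noteq> f x"
        by auto
      let ?W = "\<lambda>x. if x \<in> F then {f x} else B"
      have "finite {x \<in> A. ?W x \<noteq> topspace (discrete_topology B)}"
        by (rule finite_subset[OF _ F(1)]) auto
      moreover have "\<forall>x\<in>A. openin (discrete_topology B) (?W x)" "f \<in> Pi\<^sub>E A ?W"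
        using f by (auto simp: PiE_iff)
      moreover have "Pi\<^sub>E A ?W \<subseteq> ?T - M"
      proof
        fix g assume g: "g \<in> Pi\<^sub>E A ?W"
        have "g x = f x" if "x \<in> F" for x
          using PiE_mem[OF g, of x] that F(2) by auto
        moreover have "Pi\<^sub>E A ?W \<subseteq> ?T"
          using f by (intro PiE_mono) auto
        then have "g \<in> ?T" using g by auto
        ultimately show "g \<in> ?T - M" using F(3) by auto
      qed
      ultimately show "\<exists>U. finite {x \<in> A. U x \<noteq> topspace (discrete_topology B)} \<and>
          (\<forall>x\<in>A. openin (discrete_topology B) (U x)) \<and> f \<in> Pi\<^sub>E A U \<and> Pi\<^sub>E A U \<subseteq> ?T - M"
        by (intro exI[of _ ?W]) blast
    qed
  qed
  then show ?thesis by (auto simp: closedin_def)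
qed

definition unary_clone :: "'a set \<Rightarrow> ('a \<Rightarrow> 'a) set \<Rightarrow> (nat \<times> ('a list \<Rightarrow> 'a)) set" where
  "unary_clone X M = {(n, \<lambda>xs\<in>tuples X n. g (xs ! k)) |n k g. k < n \<and> g \<in> M}"

lemma unary_cloneI:
  "k < n \<Longrightarrow> g \<in> M \<Longrightarrow> (n, \<lambda>xs\<in>tuples X n. g (xs ! k)) \<in> unary_clone X M"
  unfolding unary_clone_def by blast

lemma nth_in_of_tuples: "xs \<in> tuples X n \<Longrightarrow> k < n \<Longrightarrow> xs ! k \<in> X"
  by (auto simp: tuples_def)

lemma replicate_in_tuples: "x \<in> X \<Longrightarrow> replicate n x \<in> tuples X n"
  by (auto simp: tuples_def)

text \<open>
  Substituting essentially unary operations into \<open>g(x\<^sub>k)\<close> only keeps the \<open>k\<close>-th of them, so the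
  result is again essentially unary.
\<close>

lemma clone_unary_clone:
  assumes M: "M \<subseteq> X \<rightarrow>\<^sub>E X" "(\<lambda>x\<in>X. x) \<in> M"
    and comp: "\<And>g h. g \<in> M \<Longrightarrow> h \<in> M \<Longrightarrow> compose X g h \<in> M"
  shows "clone X (unary_clone X M)"
  unfolding clone_def
proof (intro conjI allI impI)
  show sub: "unary_clone X M \<subseteq> all_operations X"
    using M(1) by (auto simp: unary_clone_def all_operations_def operations_def nth_in_of_tuples
        PiE_iff subset_iff)
  show "(n, projection X n k) \<in> unary_clone X M" if "n \<ge> 1" "k < n" for n k
  proof -
    have "projection X n k = (\<lambda>xs\<in>tuples X n. (\<lambda>x\<in>X. x) (xs ! k))"
      using that by (auto simp: projection_def fun_eq_iff nth_in_of_tuples)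
    with unary_cloneI[OF that(2) M(2), of X] show ?thesis by simp
  qed
  fix n m f gs
  assume A: "(n, f) \<in> unary_clone X M \<and> length gs = n \<and> (\<forall>g\<in>set gs. (m, g) \<in> unary_clone X M)"
  then obtain k g where g: "k < n" "g \<in> M" "f = (\<lambda>xs\<in>tuples X n. g (xs ! k))"
    by (auto simp: unary_clone_def)
  have "(m, gs ! k) \<in> unary_clone X M" using A g(1) by auto
  then obtain j h where h: "j < m" "h \<in> M" "gs ! k = (\<lambda>xs\<in>tuples X m. h (xs ! j))"
    by (auto simp: unary_clone_def)
  have "map (\<lambda>g. g xs) gs \<in> tuples X n" if "xs \<in> tuples X m" for xs
    using A sub that by (fastforce simp: tuples_def all_operations_def operations_def)
  then have "composition X m f gs = (\<lambda>xs\<in>tuples X m. compose X g h (xs ! j))"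
    using A g h by (auto simp: composition_def fun_eq_iff compose_def nth_in_of_tuples)
  with unary_cloneI[OF h(1) comp[OF g(2) h(2)], of X]
  show "(m, composition X m f gs) \<in> unary_clone X M"
    by simp
qed

text \<open>
  The \<open>n\<close>-ary part is a finite union, over the relevant coordinate \<open>k\<close>, of copies of \<open>M\<close>. An
  operation in its closure is thus approximated with one fixed coordinate \<open>k\<close>, and its values on
  constant tuples recover the self-map.
\<close>

lemma closedin_unary_clone:
  assumes cl: "closedin (pointwise_topology X X) M"
  shows "closedin (operation_topology X n) (unary_clone X M `` {n})"
  unfolding operation_topology_def closedin_pointwise_topology
proof (intro conjI ballI impI)
  have M: "M \<subseteq> X \<rightarrow>\<^sub>E X" using cl by (auto simp: closedin_pointwise_topology)
  then show "unary_clone X M `` {n} \<subseteq> tuples X n \<rightarrow>\<^sub>E X"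
    by (auto simp: unary_clone_def nth_in_of_tuples PiE_iff subset_iff)
  fix f assume f: "f \<in> tuples X n \<rightarrow>\<^sub>E X"
    and approx: "\<forall>F. finite F \<longrightarrow> F \<subseteq> tuples X n \<longrightarrow> (\<exists>g\<in>unary_clone X M `` {n}. \<forall>x\<in>F. g x = f x)"
  have ex: "\<exists>k<n. \<exists>g\<in>M. \<forall>xs\<in>F. f xs = g (xs ! k)" if F: "finite F" "F \<subseteq> tuples X n" for F
  proof -
    obtain u where u: "(n, u) \<in> unary_clone X M" "\<forall>xs\<in>F. u xs = f xs"
      using approx F by auto
    then obtain k g where "k < n" "g \<in> M" "u = (\<lambda>xs\<in>tuples X n. g (xs ! k))"
      by (auto simp: unary_clone_def)
    with u(2) F(2) show ?thesis by (metis restrict_apply' subsetD)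
  qed
  \<comment> \<open>If every coordinate failed on some finite set, all would fail on the union of these sets.\<close>
  have "\<exists>k<n. \<forall>F. finite F \<longrightarrow> F \<subseteq> tuples X n \<longrightarrow> (\<exists>g\<in>M. \<forall>xs\<in>F. f xs = g (xs ! k))"
  proof (rule ccontr)
    assume "\<not> ?thesis"
    then obtain G where G: "\<And>k. k < n \<Longrightarrow> finite (G k) \<and> G k \<subseteq> tuples X n \<and>
        \<not> (\<exists>g\<in>M. \<forall>xs\<in>G k. f xs = g (xs ! k))"
      by metis
    have "finite (\<Union>k<n. G k)" "(\<Union>k<n. G k) \<subseteq> tuples X n" using G by auto
    from ex[OF this] G show False by blast
  qed
  then obtain k where k: "k < n"
    and approx_k: "\<And>F. finite F \<Longrightarrow> F \<subseteq> tuples X n \<Longrightarrow> \<exists>g\<in>M. \<forall>xs\<in>F. f xs = g (xs ! k)"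
    by blast
  define g where "g = (\<lambda>x\<in>X. f (replicate n x))"
  have "g \<in> X \<rightarrow>\<^sub>E X" using f by (auto simp: g_def intro!: PiE_mem[OF f] replicate_in_tuples)
  moreover have "\<exists>h\<in>M. \<forall>x\<in>F. h x = g x" if F: "finite F" "F \<subseteq> X" for F
  proof -
    have "finite (replicate n ` F)" "replicate n ` F \<subseteq> tuples X n"
      using F by (auto simp: replicate_in_tuples)
    then obtain h where h: "h \<in> M" "\<forall>xs\<in>replicate n ` F. f xs = h (xs ! k)"
      using approx_k by blast
    then have "h x = g x" if "x \<in> F" for x
      using that F(2) k by (auto simp: g_def)
    with h(1) show ?thesis by blast
  qed
  ultimately have "g \<in> M" using cl unfolding closedin_pointwise_topology by blast
  moreover have "f = (\<lambda>xs\<in>tuples X n. g (xs ! k))"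
  proof
    fix xs show "f xs = (\<lambda>xs\<in>tuples X n. g (xs ! k)) xs"
    proof (cases "xs \<in> tuples X n")
      case True
      let ?ys = "replicate n (xs ! k)"
      have ys: "xs ! k \<in> X" "?ys \<in> tuples X n"
        using True k by (auto simp: nth_in_of_tuples replicate_in_tuples)
      with True obtain h where "f xs = h (xs ! k)" "f ?ys = h (?ys ! k)"
        using approx_k[of "{xs, ?ys}"] by auto
      with True ys k show ?thesis by (simp add: g_def)
    qed (use f in \<open>auto simp: PiE_iff extensional_def\<close>)
  qed
  ultimately show "f \<in> unary_clone X M `` {n}" using unary_cloneI[OF k, of g M X] by simp
qed

lemma unary_clone_subset_iff:
  assumes "M \<subseteq> X \<rightarrow>\<^sub>E X" "N \<subseteq> X \<rightarrow>\<^sub>E X"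
  shows "unary_clone X M \<subseteq> unary_clone X N \<longleftrightarrow> M \<subseteq> N"
proof
  assume sub: "unary_clone X M \<subseteq> unary_clone X N"
  show "M \<subseteq> N"
  proof
    fix g assume g: "g \<in> M"
    then have "(1, \<lambda>xs\<in>tuples X 1. g (xs ! 0)) \<in> unary_clone X M"
      by (intro unary_cloneI) simp
    with sub have "(1, \<lambda>xs\<in>tuples X 1. g (xs ! 0)) \<in> unary_clone X N" by blast
    then obtain h where h: "h \<in> N"
        "(\<lambda>xs\<in>tuples X 1. g (xs ! 0)) = (\<lambda>xs\<in>tuples X 1. h (xs ! 0))"
      by (auto simp: unary_clone_def)
    have "g x = h x" if "x \<in> X" for x
      using fun_cong[OF h(2), of "[x]"] that by (simp add: tuples_def)
    moreover have "g \<in> X \<rightarrow>\<^sub>E X" "h \<in> X \<rightarrow>\<^sub>E X" using g h(1) assms by auto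
    ultimately have "g = h" by (intro PiE_ext[of g X "\<lambda>_. X" h])
    with h(1) show "g \<in> N" by simp
  qed
qed (auto simp: unary_clone_def)

text \<open>
  The self-map behind an essentially unary operation can be read off on constant tuples, whatever
  coordinate the operation depends on; two representations hence use the same self-map.
\<close>

lemma unary_clone_Int:
  assumes "M \<subseteq> X \<rightarrow>\<^sub>E X" "N \<subseteq> X \<rightarrow>\<^sub>E X"
  shows "unary_clone X M \<inter> unary_clone X N = unary_clone X (M \<inter> N)"
proof
  show "unary_clone X M \<inter> unary_clone X N \<subseteq> unary_clone X (M \<inter> N)"
  proof clarify
    fix n u assume u: "(n, u) \<in> unary_clone X M" "(n, u) \<in> unary_clone X N"
    obtain k g where g: "k < n" "g \<in> M" "u = (\<lambda>xs\<in>tuples X n. g (xs ! k))"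
      using u(1) by (auto simp: unary_clone_def)
    obtain j h where h: "j < n" "h \<in> N" "u = (\<lambda>xs\<in>tuples X n. h (xs ! j))"
      using u(2) by (auto simp: unary_clone_def)
    have eq: "g (xs ! k) = h (xs ! j)" if "xs \<in> tuples X n" for xs
      using that g(3) h(3) by (metis restrict_apply')
    have "g x = h x" if "x \<in> X" for x
      using eq[of "replicate n x"] that g(1) h(1) by (simp add: replicate_in_tuples)
    moreover have "g \<in> X \<rightarrow>\<^sub>E X" "h \<in> X \<rightarrow>\<^sub>E X" using g(2) h(2) assms by auto
    ultimately have "g = h" by (intro PiE_ext[of g X "\<lambda>_. X" h])
    with g h(2) show "(n, u) \<in> unary_clone X (M \<inter> N)" by (auto intro: unary_cloneI)
  qed
qed (auto simp: unary_clone_def)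

text \<open>This gives the lower bound on a join of two clones of this kind.\<close>

lemma compose_unary_clone_subset:
  assumes "clone X C" "M \<subseteq> X \<rightarrow>\<^sub>E X" "N \<subseteq> X \<rightarrow>\<^sub>E X" 
    and "unary_clone X M \<subseteq> C" "unary_clone X N \<subseteq> C"
  shows "unary_clone X {compose X g h |g h. g \<in> M \<and> h \<in> N} \<subseteq> C"
proof clarify
  fix n u assume "(n, u) \<in> unary_clone X {compose X g h |g h. g \<in> M \<and> h \<in> N}"
  then obtain k g h where k: "k < n" "g \<in> M" "h \<in> N"
      "u = (\<lambda>xs\<in>tuples X n. compose X g h (xs ! k))"
    unfolding unary_clone_def by blast
  let ?g = "\<lambda>xs\<in>tuples X 1. g (xs ! 0)" and ?h = "\<lambda>xs\<in>tuples X n. h (xs ! k)"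
  have "(1, ?g) \<in> C" "(n, ?h) \<in> C"
    using assms(4,5) unary_cloneI[of 0 1 g M X] unary_cloneI[OF k(1,3), of X] k(2) by auto
  then have "(n, composition X n ?g [?h]) \<in> C"
    using assms(1) unfolding clone_def by simp
  moreover have "composition X n ?g [?h] = u"
  proof
    fix xs
    show "composition X n ?g [?h] xs = u xs"
    proof (cases "xs \<in> tuples X n")
      case True
      then have "xs ! k \<in> X" using k(1) by (rule nth_in_of_tuples)
      moreover from this have "h (xs ! k) \<in> X" using k(3) assms(3) by auto
      then have "[h (xs ! k)] \<in> tuples X 1" by (simp add: tuples_def)
      ultimately show ?thesis using True by (simp add: composition_def k(4) compose_def)
    qed (simp add: composition_def k(4))
  qed
  ultimately show "(n, u) \<in> C" by simp
qed

section \<open>Complete groups acting on their cosets\<close>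

text \<open>
  The subgroups \<open>U n\<close> are a neighbourhood base of \<open>0\<close> for a group topology that is Hausdorff
  (\<open>separated\<close>), complete, and separable; \<open>complete\<close> is convergence of Cauchy sequences \<open>s\<close>, with
  the rate of convergence normalised. The strict decrease makes the topology non-discrete and
  the set of cosets infinite.
\<close>

locale complete_filtered_group =
  fixes U :: "nat \<Rightarrow> 'g :: ab_group_add set"
  assumes zero_mem: "0 \<in> U n"
    and diff_mem: "x \<in> U n \<Longrightarrow> y \<in> U n \<Longrightarrow> x - y \<in> U n"
    and decreasing: "U (Suc n) \<subset> U n"
    and separated: "(\<And>n. x \<in> U n) \<Longrightarrow> x = 0"
    and complete: "(\<And>m n. m \<le> n \<Longrightarrow> s n - s m \<in> U m) \<Longrightarrow> \<exists>x. \<forall>n. x - s n \<in> U n"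
    and separable: "\<exists>D. countable D \<and> (\<forall>x n. \<exists>d\<in>D. x - d \<in> U n)"
begin

lemma uminus_mem: "x \<in> U n \<Longrightarrow> - x \<in> U n"
  using diff_mem[OF zero_mem] by simp

lemma add_mem: "x \<in> U n \<Longrightarrow> y \<in> U n \<Longrightarrow> x + y \<in> U n"
  using diff_mem[OF _ uminus_mem] by simp

definition coset :: "nat \<Rightarrow> 'g \<Rightarrow> 'g set" where
  "coset n x = (+) x ` U n"

lemma coset_eq_iff: "coset n x = coset n y \<longleftrightarrow> x - y \<in> U n"
proof
  assume "coset n x = coset n y"
  then have "x \<in> coset n y" using zero_mem[of n] by (force simp: coset_def)
  then show "x - y \<in> U n" by (auto simp: coset_def)
next
  have sub: "coset n x \<subseteq> coset n y" if d: "x - y \<in> U n" for x y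
  proof
    fix z assume "z \<in> coset n x"
    then obtain u where "u \<in> U n" "z = x + u" by (auto simp: coset_def)
    with add_mem[OF d, of u] show "z \<in> coset n y"
      by (auto simp: coset_def image_iff algebra_simps intro: bexI[of _ "x - y + u"])
  qed
  assume "x - y \<in> U n"
  with uminus_mem[OF this] show "coset n x = coset n y"
    by (intro equalityI sub) auto
qed

lemma translate_coset: "(+) g ` coset n x = coset n (g + x)"
  by (auto simp: coset_def image_image add.assoc)

definition cosets :: "'g set set" where
  "cosets = (\<Union>n. range (coset n))"

lemma coset_in_cosets [simp]: "coset n x \<in> cosets"
  unfolding cosets_def by blast

lemma countable_cosets: "countable cosets"
proof -
  obtain D where D: "countable D" "\<And>x n. \<exists>d\<in>D. x - d \<in> U n"
    using separable by auto
  have "cosets \<subseteq> (\<lambda>(n, d). coset n d) ` (UNIV \<times> D)"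
  proof
    fix c assume "c \<in> cosets"
    then obtain n x where c: "c = coset n x" by (auto simp: cosets_def)
    obtain d where "d \<in> D" "x - d \<in> U n" using D(2) by blast
    then show "c \<in> (\<lambda>(n, d). coset n d) ` (UNIV \<times> D)"
      using coset_eq_iff[of n x d] by (intro image_eqI[of _ _ "(n, d)"]) (simp_all add: c)
  qed
  moreover have "countable ((\<lambda>(n, d). coset n d) ` (UNIV \<times> D))"
    using D(1) by auto
  ultimately show ?thesis by (rule countable_subset)
qed

lemma U_mono: "m \<le> n \<Longrightarrow> U n \<subseteq> U m"
  by (rule lift_Suc_antimono_le[of U]) (rule psubset_imp_subset[OF decreasing])

lemma U_eq_coset: "U n = coset n 0"
  by (simp add: coset_def)

lemma infinite_cosets: "infinite cosets"
proof -
  have "U m \<noteq> U n" if "m < n" for m n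
    using U_mono[of "Suc m" n] decreasing[of m] that by auto
  then have "inj U" by (rule linorder_injI)
  then have "infinite (range U)" by (rule range_inj_infinite)
  moreover have "range U \<subseteq> cosets"
  proof
    fix A assume "A \<in> range U"
    then obtain n where "A = U n" by blast
    then show "A \<in> cosets" using coset_in_cosets[of n 0] U_eq_coset[of n] by simp
  qed
  ultimately show ?thesis by (rule infinite_super[rotated])
qed

definition closed_subset :: "'g set \<Rightarrow> bool" where
  "closed_subset H \<longleftrightarrow> (\<forall>x. (\<forall>n. \<exists>h\<in>H. x - h \<in> U n) \<longrightarrow> x \<in> H)"

text \<open>
  The images of the cosets \<open>U n\<close> under \<open>f\<close> are nested cosets, which shrink to a point \<open>x\<close> by
  completeness. Comparing \<open>f\<close> on an arbitrary coset of \<open>U n\<close> with \<open>f\<close> on \<open>U n\<close> itself, by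
  means of a single approximating translation, shows that \<open>f\<close> is the translation by \<open>x\<close>.
\<close>

lemma limit_translation_is_translation:
  assumes H: "closed_subset H"
    and approx: "\<And>F. finite F \<Longrightarrow> F \<subseteq> cosets \<Longrightarrow> \<exists>h\<in>H. \<forall>c\<in>F. f c = (+) h ` c"
  shows "\<exists>h\<in>H. \<forall>c\<in>cosets. f c = (+) h ` c"
proof -
  have "\<exists>h\<in>H. f (coset n 0) = coset n h" for n
  proof -
    have "\<exists>h\<in>H. \<forall>c\<in>{coset n 0}. f c = (+) h ` c"
      by (rule approx) simp_all
    then show ?thesis by (simp add: translate_coset)
  qed
  then obtain s where s: "\<And>n. s n \<in> H" "\<And>n. f (coset n 0) = coset n (s n)" by metis
  have translate2: "\<exists>h. coset n (s n) = coset n h \<and> f (coset m y) = coset m (h + y)" for m n y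
  proof -
    have "\<exists>h\<in>H. \<forall>c\<in>{coset n 0, coset m y}. f c = (+) h ` c"
      by (rule approx) simp_all
    then obtain h where h: "\<forall>c\<in>{coset n 0, coset m y}. f c = (+) h ` c" by blast
    then have "f (coset n 0) = coset n (h + 0)" "f (coset m y) = coset m (h + y)"
      by (simp_all add: translate_coset)
    with s(2) show ?thesis by (intro exI[of _ h]) simp
  qed
  have "s n - s m \<in> U m" if "m \<le> n" for m n
  proof -
    obtain h where "coset n (s n) = coset n h" "coset m (s m) = coset m h"
      using translate2[of n m 0] s(2)[of m] by auto
    then have "s n - h \<in> U m" "h - s m \<in> U m"
      using U_mono[OF that] coset_eq_iff[of m h "s m"] coset_eq_iff[of n "s n" h] by auto
    from add_mem[OF this] show ?thesis by simp
  qed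
  then obtain x where x: "\<And>n. x - s n \<in> U n" using complete by blast
  then have "x \<in> H" using H s(1) unfolding closed_subset_def by blast
  moreover have "f c = (+) x ` c" if "c \<in> cosets" for c
  proof -
    from that obtain n y where c: "c = coset n y" by (auto simp: cosets_def)
    obtain h where h: "coset n (s n) = coset n h" "f c = coset n (h + y)"
      using translate2[of n n y] c by auto
    then have "s n - h \<in> U n" by (simp add: coset_eq_iff)
    from add_mem[OF x this] have "coset n (x + y) = coset n (h + y)"
      by (simp add: coset_eq_iff)
    with h show ?thesis by (simp add: c translate_coset)
  qed
  ultimately show ?thesis by blast
qed

text \<open>
  The set \<open>X\<close> is identified with the countably infinite set of cosets, on which the group acts by
  translations.
\<close>

lemma translation_action:
  fixes X :: "'a set"
  assumes X: "countable X" "infinite X"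
  obtains act :: "'g \<Rightarrow> 'a \<Rightarrow> 'a" where
    "\<And>g. act g \<in> X \<rightarrow>\<^sub>E X"
    "act 0 = (\<lambda>x\<in>X. x)"
    "\<And>g h. act (g + h) = compose X (act g) (act h)"
    "inj act"
    "\<And>H. closed_subset H \<Longrightarrow> closedin (pointwise_topology X X) (act ` H)"
proof -
  obtain \<beta> where \<beta>: "bij_betw \<beta> cosets X"
    using X countable_cosets infinite_cosets
    by (metis bij_betw_inv bij_betw_trans countableE_infinite)
  define \<gamma> where "\<gamma> = inv_into cosets \<beta>"
  have \<gamma>: "\<And>x. x \<in> X \<Longrightarrow> \<gamma> x \<in> cosets" "\<And>x. x \<in> X \<Longrightarrow> \<beta> (\<gamma> x) = x"
      "\<And>c. c \<in> cosets \<Longrightarrow> \<gamma> (\<beta> c) = c" "\<And>c. c \<in> cosets \<Longrightarrow> \<beta> c \<in> X"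
    using bij_betw_inv_into_right[OF \<beta>] bij_betw_inv_into_left[OF \<beta>]
      bij_betw_apply[OF bij_betw_inv_into[OF \<beta>]] bij_betw_apply[OF \<beta>]
    by (simp_all add: \<gamma>_def)
  have tr: "(+) g ` c \<in> cosets" if "c \<in> cosets" for g c
  proof -
    from that obtain n x where "c = coset n x" by (auto simp: cosets_def)
    then show ?thesis by (simp add: translate_coset)
  qed
  define act where "act g = (\<lambda>x\<in>X. \<beta> ((+) g ` \<gamma> x))" for g
  show thesis
  proof
    show act_X: "act g \<in> X \<rightarrow>\<^sub>E X" for g by (simp add: act_def \<gamma> tr)
    show "act 0 = (\<lambda>x\<in>X. x)" by (simp add: act_def \<gamma> cong: restrict_cong)
    show "act (g + h) = compose X (act g) (act h)" for g h
      by (rule ext) (simp add: act_def compose_def \<gamma> tr image_image add.assoc)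
    \<comment> \<open>The images of the cosets \<open>U n\<close> determine \<open>g\<close> modulo every \<open>U n\<close>.\<close>
    have "g = h" if "act g = act h" for g h
    proof -
      have "coset n g = coset n h" for n
      proof -
        have "\<gamma> (act g (\<beta> (coset n 0))) = \<gamma> (act h (\<beta> (coset n 0)))" using that by simp
        then show ?thesis by (simp add: act_def \<gamma> tr) (simp add: translate_coset)
      qed
      then show ?thesis using separated[of "g - h"] by (simp add: coset_eq_iff)
    qed
    then show "inj act" by (rule injI)
    fix H assume H: "closed_subset H"
    show "closedin (pointwise_topology X X) (act ` H)"
      unfolding closedin_pointwise_topology
    proof (intro conjI ballI impI)
      show "act ` H \<subseteq> X \<rightarrow>\<^sub>E X" using act_X by blast
      fix f assume f: "f \<in> X \<rightarrow>\<^sub>E X"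
        and approx: "\<forall>F. finite F \<longrightarrow> F \<subseteq> X \<longrightarrow> (\<exists>g\<in>act ` H. \<forall>x\<in>F. g x = f x)"
      have "\<exists>h\<in>H. \<forall>c\<in>F. \<gamma> (f (\<beta> c)) = (+) h ` c" if F: "finite F" "F \<subseteq> cosets" for F
      proof -
        have "finite (\<beta> ` F)" "\<beta> ` F \<subseteq> X" using F \<gamma>(4) by auto
        then have "\<exists>g\<in>act ` H. \<forall>x\<in>\<beta> ` F. g x = f x" by (rule approx[rule_format])
        then obtain h where h: "h \<in> H" "\<forall>x\<in>\<beta> ` F. act h x = f x" by (elim bexE imageE) simp
        have "\<gamma> (f (\<beta> c)) = (+) h ` c" if "c \<in> F" for c
        proof -
          have "c \<in> cosets" using that F(2) by blast
          then have "\<gamma> (act h (\<beta> c)) = (+) h ` c" by (simp add: act_def \<gamma> tr)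
          then show ?thesis using h(2) that by simp
        qed
        with h(1) show ?thesis by blast
      qed
      then have "\<exists>h\<in>H. \<forall>c\<in>cosets. \<gamma> (f (\<beta> c)) = (+) h ` c"
        by (rule limit_translation_is_translation[OF H])
      then obtain h where h: "h \<in> H" "\<And>c. c \<in> cosets \<Longrightarrow> \<gamma> (f (\<beta> c)) = (+) h ` c"
        by blast
      have "f x = act h x" if "x \<in> X" for x
      proof -
        have "f x = \<beta> (\<gamma> (f x))" using PiE_mem[OF f that] by (simp add: \<gamma>)
        also have "\<gamma> (f x) = (+) h ` \<gamma> x" using h(2)[of "\<gamma> x"] that by (simp add: \<gamma>)
        finally show ?thesis using that by (simp add: act_def)
      qed
      then have "f = act h" using f act_X by (intro PiE_ext[of f X "\<lambda>_. X"])
      with h(1) show "f \<in> act ` H" by simp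
    qed
  qed
qed

text \<open>
  The bottom and the top of the sublattice are the clones of the translations by \<open>0\<close> and by all group
  elements. A clone above those of \<open>H i\<close> and \<open>H j\<close> contains all translations, because each one is a
  composition of a translation by an element of \<open>H i\<close> and one by an element of \<open>H j\<close>.
\<close>

theorem complementary_closed_submonoids_give_M_lattice:
  fixes X :: "'a set" and H :: "'i \<Rightarrow> 'g set"
  assumes X: "countable X" "infinite X"
    and zero: "\<And>i. i \<in> I \<Longrightarrow> 0 \<in> H i"
    and add: "\<And>i x y. i \<in> I \<Longrightarrow> x \<in> H i \<Longrightarrow> y \<in> H i \<Longrightarrow> x + y \<in> H i"
    and closed: "\<And>i. i \<in> I \<Longrightarrow> closed_subset (H i)"
    and proper: "\<And>i. i \<in> I \<Longrightarrow> H i \<noteq> {0}" "\<And>i. i \<in> I \<Longrightarrow> H i \<noteq> UNIV"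
    and disjoint: "\<And>i j. i \<in> I \<Longrightarrow> j \<in> I \<Longrightarrow> i \<noteq> j \<Longrightarrow> H i \<inter> H j = {0}"
    and spanning: "\<And>i j x. i \<in> I \<Longrightarrow> j \<in> I \<Longrightarrow> i \<noteq> j \<Longrightarrow> \<exists>y\<in>H i. \<exists>z\<in>H j. x = y + z"
  shows "\<exists>S. sublattice S (Cl_loc X) \<and>
             lattice_isomorphic (M_lattice I) ((Cl_loc X)\<lparr>carrier := S\<rparr>)"
proof -
  obtain act :: "'g \<Rightarrow> 'a \<Rightarrow> 'a" where act: "\<And>g. act g \<in> X \<rightarrow>\<^sub>E X"
    "act 0 = (\<lambda>x\<in>X. x)" "\<And>g h. act (g + h) = compose X (act g) (act h)" "inj act"
    "\<And>H. closed_subset H \<Longrightarrow> closedin (pointwise_topology X X) (act ` H)"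
    by (rule translation_action[OF X]) blast
  define C where "C H = unary_clone X (act ` H)" for H
  have act_sub: "act ` H \<subseteq> X \<rightarrow>\<^sub>E X" for H using act(1) by auto
  have C_sub: "C H \<subseteq> C H' \<longleftrightarrow> H \<subseteq> H'" for H H'
    using act(4) by (simp add: C_def unary_clone_subset_iff[OF act_sub act_sub] inj_image_subset_iff)
  have C_eq: "C H = C H' \<longleftrightarrow> H = H'" for H H'
    using C_sub by blast
  have local: "local_clone X (C H)"
    if "0 \<in> H" "\<And>x y. x \<in> H \<Longrightarrow> y \<in> H \<Longrightarrow> x + y \<in> H" "closed_subset H" for H
    unfolding local_clone_def C_def
  proof (intro conjI allI impI clone_unary_clone act_sub closedin_unary_clone act(5)[OF that(3)])
    show "(\<lambda>x\<in>X. x) \<in> act ` H" using act(2) that(1) by (metis imageI)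
    show "compose X g h \<in> act ` H" if "g \<in> act ` H" "h \<in> act ` H" for g h
      using that \<open>\<And>x y. x \<in> H \<Longrightarrow> y \<in> H \<Longrightarrow> x + y \<in> H\<close> act(3)
      by (metis (no_types, lifting) imageE imageI)
  qed
  have closed0: "closed_subset {0}" 
    using separated by (auto simp: closed_subset_def)
  have local_H: "local_clone X (C (H i))" if "i \<in> I" for i
    using that by (intro local zero add closed)
  have local_0: "local_clone X (C {0})" and local_UNIV: "local_clone X (C UNIV)"
    using closed0 by (auto intro!: local simp: closed_subset_def)
  interpret lattice "Cl_loc X" by (rule lattice_Cl_loc)
  show ?thesis
  proof (rule M_lattice_isomorphic_sublattice[where b = "C {0}" and t = "C UNIV" and a = "\<lambda>i. C (H i)"])
    show "C {0} \<noteq> C UNIV"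
      unfolding C_eq
    proof -
      obtain x where "x \<in> U 0" "x \<notin> U 1" using decreasing[of 0] by auto
      then have "x \<noteq> 0" using zero_mem by metis
      then show "{0} \<noteq> (UNIV :: 'g set)" by auto
    qed
    fix i j assume ij: "i \<in> I" "j \<in> I" "i \<noteq> j"
    show "C (H i) \<sqinter>\<^bsub>Cl_loc X\<^esub> C (H j) = C {0}"
      using ij disjoint[OF ij] local_H act(4)
      by (simp add: meet_Cl_loc C_def unary_clone_Int[OF act_sub act_sub] image_Int[symmetric])
    show "C (H i) \<squnion>\<^bsub>Cl_loc X\<^esub> C (H j) = C UNIV"
    proof (rule join_Cl_loc_eqI)
      fix E assume E: "local_clone X E" "C (H i) \<subseteq> E" "C (H j) \<subseteq> E"
      have "{compose X g h |g h. g \<in> act ` H i \<and> h \<in> act ` H j} = range act"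
        using spanning[OF ij] by (auto simp: act(3)[symmetric]) (metis act(3) imageI)
      with compose_unary_clone_subset[of X E "act ` H i" "act ` H j"] E act_sub
      show "C UNIV \<subseteq> E" by (simp add: C_def local_clone_def)
    qed (use ij local_H local_UNIV C_sub in auto)
  qed (use local_H local_0 local_UNIV C_sub C_eq proper proper[symmetric] zero in \<open>auto simp: Cl_loc_def\<close>)
qed

end


section \<open>Lines in the plane over the field of Laurent series\<close>

unbundle fps_syntax

definition vanishing_below :: "nat \<Rightarrow> (rat fls \<times> rat fls) set" where
  "vanishing_below n = {(f, g). \<forall>i<int n. f $$ i = 0 \<and> g $$ i = 0}"

text \<open>
  The coefficients of \<open>s n\<close> below \<open>n\<close> are final, so the limit is formed coefficientwise. It is again
  a Laurent series because its negative part is that of \<open>s 0\<close>.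
\<close>

lemma complete_fls:
  fixes s :: "nat \<Rightarrow> 'a :: ab_group_add fls"
  assumes "\<And>m n i. m \<le> n \<Longrightarrow> i < int m \<Longrightarrow> (s n - s m) $$ i = 0"
  shows "\<exists>f. \<forall>n. \<forall>i<int n. (f - s n) $$ i = 0"
proof -
  define c where "c i = s (nat (i + 1)) $$ i" for i
  have c: "c i = s n $$ i" if "i < int n" for n i
    using assms[of "nat (i + 1)" n i] assms[of 0 n i] that by (cases "i < 0") (auto simp: c_def)
  obtain N where "\<forall>i<N. s 0 $$ i = 0" by (rule fls_nth_vanishes_belowE)
  then have "\<forall>i<min N 0. c i = 0" using c[of _ 0] by auto
  then have "Abs_fls c $$ i = c i" for i by (rule nth_Abs_fls_lower_bound)
  with c show ?thesis by (intro exI[of _ "Abs_fls c"]) auto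
qed

text \<open>Laurent polynomials over a countable coefficient group are dense and countable.\<close>

lemma separable_fls:
  "\<exists>D :: 'a :: {countable, ab_group_add} fls set. countable D \<and> (\<forall>f n. \<exists>d\<in>D. \<forall>i<int n. (f - d) $$ i = 0)"
proof -
  \<comment> \<open>\<open>P (N, l)\<close> has the coefficients listed in \<open>l\<close>, starting with the one of \<open>t\<close> to the power \<open>N\<close>.\<close>
  define P :: "int \<times> 'a list \<Rightarrow> 'a fls" where
    "P = (\<lambda>(N, l). Abs_fls (\<lambda>i. if N \<le> i \<and> nat (i - N) < length l then l ! nat (i - N) else 0))"
  have P: "P (N, l) $$ i = (if N \<le> i \<and> nat (i - N) < length l then l ! nat (i - N) else 0)" for N l i
    unfolding P_def prod.case by (rule nth_Abs_fls_lower_bound[of N]) auto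
  have "\<exists>d\<in>range P. \<forall>i<int n. (f - d) $$ i = 0" for f n
  proof -
    obtain N where N: "\<forall>i<N. f $$ i = 0" by (rule fls_nth_vanishes_belowE)
    let ?d = "P (N, map (\<lambda>k. f $$ (N + int k)) [0..<nat (int n - N)])"
    have "(f - ?d) $$ i = 0" if "i < int n" for i
      using N that by (cases "i < N") (auto simp: P)
    then show ?thesis by blast
  qed
  moreover have "countable (range P)" by simp
  ultimately show ?thesis by blast
qed

interpretation fls_plane: complete_filtered_group vanishing_below
proof
  fix n
  show "vanishing_below (Suc n) \<subset> vanishing_below n"
  proof
    show "vanishing_below (Suc n) \<subseteq> vanishing_below n" by (auto simp: vanishing_below_def)
    have "(fls_X ^ n, 0) \<in> vanishing_below n - vanishing_below (Suc n)"
      by (auto simp: vanishing_below_def fls_X_power_nth intro!: exI[of _ "int n"])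
    then show "vanishing_below (Suc n) \<noteq> vanishing_below n" by blast
  qed
next
  fix x assume "\<And>n. x \<in> vanishing_below n"
  then have "fst x $$ i = 0 \<and> snd x $$ i = 0" for i
    by (cases x) (force simp: vanishing_below_def dest: spec[of _ "nat (i + 1)"])
  then show "x = 0" by (simp add: prod_eq_iff fls_eq_iff)
next
  fix s :: "nat \<Rightarrow> rat fls \<times> rat fls"
  assume s: "\<And>m n. m \<le> n \<Longrightarrow> s n - s m \<in> vanishing_below m"
  obtain f where f: "\<forall>n. \<forall>i<int n. (f - fst (s n)) $$ i = 0"
    using complete_fls[of "fst \<circ> s"] s by (force simp: vanishing_below_def split_beta)
  obtain g where g: "\<forall>n. \<forall>i<int n. (g - snd (s n)) $$ i = 0"
    using complete_fls[of "snd \<circ> s"] s by (force simp: vanishing_below_def split_beta)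
  show "\<exists>x. \<forall>n. x - s n \<in> vanishing_below n"
    using f g by (intro exI[of _ "(f, g)"]) (simp add: vanishing_below_def split_beta)
next
  obtain D :: "rat fls set" where D: "countable D" "\<And>f n. \<exists>d\<in>D. \<forall>i<int n. (f - d) $$ i = 0"
    using separable_fls by blast
  have "\<exists>d\<in>D \<times> D. x - d \<in> vanishing_below n" for x n
    using D(2)[of n "fst x"] D(2)[of n "snd x"] by (fastforce simp: vanishing_below_def split_beta)
  with D(1) show "\<exists>D. countable D \<and> (\<forall>x n. \<exists>d\<in>D. x - d \<in> vanishing_below n)"
    by (intro exI[of _ "D \<times> D"]) auto
qed (auto simp: vanishing_below_def zero_prod_def)

definition line :: "rat fls \<Rightarrow> (rat fls \<times> rat fls) set" where
  "line a = {(x, a * x) |x. True}"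

text \<open>
  Multiplication by a power series does not increase the \<open>t\<close>-adic distance: if \<open>(x, a x)\<close> agrees with
  \<open>(f, g)\<close> below some exponent, then \<open>a x\<close> agrees there both with \<open>g\<close> and with \<open>a f\<close>.
\<close>

lemma closed_line:
  assumes "fls_subdegree a \<ge> 0"
  shows "fls_plane.closed_subset (line a)"
  unfolding fls_plane.closed_subset_def
proof (intro allI impI)
  fix p assume p: "\<forall>n. \<exists>h\<in>line a. p - h \<in> vanishing_below n"
  obtain f g where fg: "p = (f, g)" by force
  have "(g - a * f) $$ i = 0" for i
  proof -
    obtain x where x: "(f - x) $$ j = 0" "(g - a * x) $$ j = 0" if "j < int (nat (i + 1))" for j
      using p[rule_format, of "nat (i + 1)"] by (force simp: line_def vanishing_below_def fg)
    have "(a * (f - x)) $$ i = 0"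
    proof (cases "f - x = 0")
      case False
      then have "int (nat (i + 1)) \<le> fls_subdegree (f - x)"
        using x(1) by (intro fls_subdegree_geI) auto
      with assms have "i < fls_subdegree a + fls_subdegree (f - x)" by linarith
      then show ?thesis by (rule fls_times_nth_eq0)
    qed auto
    moreover have "(g - a * x) $$ i = 0" using x(2) by simp
    moreover have "g - a * f = (g - a * x) - a * (f - x)" by (simp add: algebra_simps)
    ultimately show ?thesis by (metis diff_zero fls_minus_nth)
  qed
  then have "g = a * f" by (metis eq_iff_diff_eq_0 fls_zero_eqI)
  then show "p \<in> line a" by (auto simp: fg line_def)
qed

lemma lines_disjoint: "a \<noteq> b \<Longrightarrow> line a \<inter> line b = {0}"
  by (auto simp: line_def zero_prod_def)

lemma lines_spanning:
  assumes "a \<noteq> b"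
  shows "\<exists>y\<in>line a. \<exists>z\<in>line b. p = y + z"
proof -
  obtain f g where p: "p = (f, g)" by force
  \<comment> \<open>The point \<open>(u, a u)\<close> is where the line of slope \<open>a\<close> meets the parallel through \<open>p\<close> to the other line.\<close>
  define u where "u = (g - b * f) / (a - b)"
  have "(a - b) * u = g - b * f" using assms by (simp add: u_def)
  then have "g = a * u + b * (f - u)" by (simp add: algebra_simps)
  then have "p = (u, a * u) + (f - u, b * (f - u))" by (simp add: p)
  moreover have "(u, a * u) \<in> line a" "(f - u, b * (f - u)) \<in> line b" by (auto simp: line_def)
  ultimately show ?thesis by blast
qed

definition char_series :: "nat set \<Rightarrow> rat fls" where
  "char_series A = fps_to_fls (Abs_fps (indicator A))"

lemma inj_char_series: "inj char_series"
proof (rule injI)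
  fix A B assume "char_series A = char_series B"
  then have "indicator A n = (indicator B n :: rat)" for n
    by (metis Abs_fps_inverse UNIV_I char_series_def fps_nth_Abs_fps fps_to_fls_eq_iff)
  then show "A = B" by (metis indicator_eq_1_iff subsetI subset_antisym)
qed

theorem theorem14:
  fixes X :: "'a set"
  assumes "countable X" and "infinite X"
  shows "\<exists>S. sublattice S (Cl_loc X) \<and>
             lattice_isomorphic M_continuum ((Cl_loc X)\<lparr>carrier := S\<rparr>)"
  unfolding M_continuum_def
proof (rule fls_plane.complementary_closed_submonoids_give_M_lattice[OF assms,
      where H = "\<lambda>A. line (char_series A)"])
  fix A :: "nat set"
  show "0 \<in> line (char_series A)" by (auto simp: line_def zero_prod_def)
  show "x + y \<in> line (char_series A)" if "x \<in> line (char_series A)" "y \<in> line (char_series A)" for x y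
    using that by (auto simp: line_def algebra_simps)
  show "fls_plane.closed_subset (line (char_series A))"
    by (rule closed_line) (simp add: char_series_def fls_subdegree_fls_to_fps_gt0)
  have "(1, char_series A) \<in> line (char_series A)" by (simp add: line_def)
  then show "line (char_series A) \<noteq> {0}" by (auto simp: zero_prod_def)
  have "(0, 1) \<notin> line (char_series A)" by (simp add: line_def)
  then show "line (char_series A) \<noteq> UNIV" by blast
  fix B assume "A \<noteq> B"
  then have "char_series A \<noteq> char_series B" using inj_char_series by (metis injD)
  then show "line (char_series A) \<inter> line (char_series B) = {0}"
    "\<exists>y\<in>line (char_series A). \<exists>z\<in>line (char_series B). x = y + z" for x
    by (simp_all add: lines_disjoint lines_spanning)
qed

end
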